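(* Let $e\ge 3$ be an integer, let $I=\{0,1,\dots,e-1\}$ (identified with $\mathbb Z/e\mathbb Z$), let $k,i\in I$, and let $\lambda$ be a partition, with residues taken with respect to $\Lambda_i$. Then the Young-diagram subdivision $\Phi_k^{Y}(\lambda)$ and the abacus subdivision $\Phi_k^{A}(\lambda)$ (computed from any abacus subdivision datum $(a,c,d,a')$ for $\lambda$) coincide: $\Phi_k^{Y}(\lambda)=\Phi_k^{A}(\lambda)$.
   Context: Partitions are identified with Young diagrams; the node $(r,c)$ (row $r$, column $c$, English convention) has content $c-r$ and residue $\operatorname{res}(r,c)\equiv i+c-r \pmod e$. $\ell(\lambda)$ is the number of nonzero parts. An $s$-node is a node of residue $s$; residues $k+1$ are read modulo $e$. **Young-diagram subdivision $\Phi^Y_k$.** A $(k,k+1)$-strip in $[\lambda]$ is a finite sequence of nodes $A_1,A_2,\dots$ of residues alternately $k,k+1,k,\dots$ (starting with $k$) such that each $k+1$-node is immediately to the right of the preceding $k$-node and each later $k$-node is immediately below the preceding $(k+1)$-node. A $(k+1,k)$-strip is defined in the same way but starting with residue $k+1$ (each $k$-node is immediately below the preceding $(k+1)$-node, and each later $(k+1)$-node is immediately to the right of the preceding $k$-node). A strip is maximal if it cannot be extended (at either end) to a longer strip of either kind. Maximal $(k,k+1)$-strips start in the first row, maximal $(k+1,k)$-strips start in the first column. For each maximal $(k,k+1)$-strip insert a new node immediately to the right of every $k$-node in it; for each maximal $(k+1,k)$-strip insert a new node immediately above every $k$-node in it. The resulting diagram is the Young diagram of the partition $\Phi^Y_k(\lambda)$.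 Precisely, in terms of diagonals: let $\delta_c$ be the number of nodes of content $c$ in $[\lambda]$. For every integer $c$ with $i+c\equiv k\pmod e$, a new diagonal with $\delta_c$ nodes is inserted between the diagonals of content $c$ and $c+1$; if $c\ge 0$ this pushes all diagonals of content $\ge c+1$ one step to the right, and if $c<0$ it pushes all diagonals of content $\le c$ one step down, the main diagonal (content $0$) always staying the main diagonal. $\Phi^Y_k(\lambda)$ is the unique partition with the resulting sequence of diagonal lengths. **Abacus subdivision $\Phi^A_k$.** An abacus subdivision datum for $\lambda$ is a tuple $(a,c,d,a')\in\mathbb Z^4$ with $a\ge\max\{k,\ell(\lambda)\}$, $a\equiv i\pmod e$, $a+d=ce+k$, $d\in\{0,\dots,e-1\}$, $a'=a+c$. The $e$-abacus of $\lambda$ with $a$ beads has runners $0,\dots,e-1$ from left to right, position $qe+b$ ($0\le b<e$) being in row $q\ge 0$ of runner $b$, and has beads exactly at the positions $\beta_j=\lambda_j-j+a$, $1\le j\le a$. Insert a new runner immediately to the left of the $k$-runner, put $c$ beads on it in its top $c$ rows (rows $0,\dots,c-1$), and relabel the runners $0,1,\dots,e$ from left to right. The result is an $(e+1)$-abacus with $a'$ beads, and $\Phi^A_k(\lambda)$ is the partition $\mu$ whose $a'$-beta set $\{\mu_j-j+a'\mid 1\le j\le a'\}$ is the set of bead positions of this $(e+1)$-abacus. *)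

theory Defs
  imports Main
begin

definition is_partition :: "nat list \<Rightarrow> bool" where
  "is_partition la \<longleftrightarrow> sorted_wrt (\<ge>) la \<and> 0 \<notin> set la"

text \<open>The parts are indexed from 1 and continued by zeros; the number of nonzero parts of a
  partition is the length of the list.\<close>

definition part :: "nat list \<Rightarrow> nat \<Rightarrow> nat" where
  "part la j = (if 1 \<le> j \<and> j \<le> length la then la ! (j - 1) else 0)"

definition young :: "nat list \<Rightarrow> (nat \<times> nat) set" where
  "young la = {(r, c). 1 \<le> r \<and> 1 \<le> c \<and> c \<le> part la r}"

definition content :: "nat \<times> nat \<Rightarrow> int" where
  "content A = int (snd A) - int (fst A)"

definition diag :: "nat list \<Rightarrow> int \<Rightarrow> nat" where
  "diag la c = card {A \<in> young la. content A = c}"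


section \<open>Subdivision of Young diagrams\<close>

text \<open>The diagonal of content \<open>c\<close> consists of \<open>k\<close>-nodes.\<close>

definition k_diagonal :: "int \<Rightarrow> int \<Rightarrow> int \<Rightarrow> int \<Rightarrow> bool" where
  "k_diagonal e k i c \<longleftrightarrow> (i + c) mod e = k"

text \<open>For every \<open>k\<close>-diagonal \<open>b\<close> a new diagonal is inserted between the diagonals \<open>b\<close> and
  \<open>b + 1\<close>.  If \<open>b \<ge> 0\<close>, this moves the diagonals of content \<open>\<ge> b + 1\<close> one step to the right;
  if \<open>b < 0\<close>, it moves those of content \<open>\<le> b\<close> one step down.  Thus \<open>new_content e k i c\<close> is the
  content, in the resulting diagram, of the old diagonal of content \<open>c\<close>, and the diagonal inserted
  after \<open>b\<close> gets content \<open>new_content e k i b + 1\<close>.\<close>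

definition new_content :: "int \<Rightarrow> int \<Rightarrow> int \<Rightarrow> int \<Rightarrow> int" where
  "new_content e k i c = c
     + int (card {b. 0 \<le> b \<and> b + 1 \<le> c \<and> k_diagonal e k i b})
     - int (card {b. b < 0 \<and> c \<le> b \<and> k_diagonal e k i b})"

definition Phi_Y :: "int \<Rightarrow> int \<Rightarrow> int \<Rightarrow> nat list \<Rightarrow> nat list" where
  "Phi_Y e k i la = (THE mu. is_partition mu \<and>
     (\<forall>c. diag mu (new_content e k i c) = diag la c) \<and>
     (\<forall>b. k_diagonal e k i b \<longrightarrow> diag mu (new_content e k i b + 1) = diag la b))"


section \<open>Subdivision of abaci\<close>

definition beta_set :: "nat list \<Rightarrow> int \<Rightarrow> int set" where
  "beta_set la a = {int (part la j) - int j + a | j. 1 \<le> j \<and> int j \<le> a}"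

definition abacus_datum :: "int \<Rightarrow> int \<Rightarrow> int \<Rightarrow> nat list \<Rightarrow> int \<times> int \<times> int \<times> int \<Rightarrow> bool" where
  "abacus_datum e k i la = (\<lambda>(a, c, d, a').
     a \<ge> max k (int (length la)) \<and> a mod e = i mod e \<and> a + d = c * e + k \<and>
     d \<in> {0..e - 1} \<and> a' = a + c)"

text \<open>An \<open>e\<close>-abacus is represented by the set of its beads, a bead in row \<open>q\<close> of runner \<open>b\<close>
  being the pair \<open>(q, b)\<close>.\<close>

definition abacus :: "int \<Rightarrow> nat list \<Rightarrow> int \<Rightarrow> (int \<times> int) set" where
  "abacus e la a = {(q, b). 0 \<le> q \<and> 0 \<le> b \<and> b < e \<and> q * e + b \<in> beta_set la a}"

definition insert_runner :: "int \<Rightarrow> int \<Rightarrow> (int \<times> int) set \<Rightarrow> (int \<times> int) set" where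
  "insert_runner k c X =
     {(q, b). (q, b) \<in> X \<and> b < k} \<union> {(q, k) | q. 0 \<le> q \<and> q < c} \<union>
     {(q, b + 1) | q b. (q, b) \<in> X \<and> k \<le> b}"

definition bead_positions :: "int \<Rightarrow> (int \<times> int) set \<Rightarrow> int set" where
  "bead_positions e X = {q * e + b | q b. (q, b) \<in> X}"

text \<open>A beta set with \<open>a'\<close> elements determines the partition only among the partitions with at most
  \<open>a'\<close> parts, hence the bound on the length of \<open>mu\<close>.\<close>

definition Phi_A :: "int \<Rightarrow> int \<Rightarrow> int \<times> int \<times> int \<times> int \<Rightarrow> nat list \<Rightarrow> nat list" where
  "Phi_A e k = (\<lambda>(a, c, d, a') la. THE mu. is_partition mu \<and> int (length mu) \<le> a' \<and>
     beta_set mu a' = bead_positions (e + 1) (insert_runner k c (abacus e la a)))"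


section \<open>Both subdivisions are well defined\<close>

lemma part_antimono:
  assumes "is_partition la" "1 \<le> i" "i \<le> j"
  shows "part la j \<le> part la i"
proof (cases "i < j \<and> j \<le> length la")
  case True
  then show ?thesis
    using assms sorted_wrt_nth_less[of "(\<ge>)" la "i - 1" "j - 1"]
    by (auto simp: is_partition_def part_def)
next
  case False
  then show ?thesis using assms by (auto simp: part_def)
qed

lemma part_pos_iff:
  assumes "is_partition la"
  shows "0 < part la j \<longleftrightarrow> 1 \<le> j \<and> j \<le> length la"
proof -
  have "0 < la ! (j - 1)" if "1 \<le> j" "j \<le> length la"
  proof -
    have "la ! (j - 1) \<in> set la" using that by auto
    then show ?thesis using assms unfolding is_partition_def by (metis gr0I)
  qed
  then show ?thesis by (auto simp: part_def)
qed

lemma partition_eqI: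
  assumes "is_partition la" "is_partition mu" "\<And>j. 1 \<le> j \<Longrightarrow> part la j = part mu j"
  shows "la = mu"
proof -
  have "\<And>j. 1 \<le> j \<Longrightarrow> j \<le> length la \<longleftrightarrow> j \<le> length mu"
    using assms part_pos_iff by metis
  then have l: "length la = length mu"
    by (metis One_nat_def le_antisym less_Suc0 linorder_not_less nle_le)
  show ?thesis
  proof (rule nth_equalityI[OF l])
    fix n assume "n < length la"
    then show "la ! n = mu ! n" using assms(3)[of "Suc n"] l by (simp add: part_def)
  qed
qed

lemma ex_partition:
  fixes g :: "nat \<Rightarrow> nat"
  assumes anti: "\<And>i j. 1 \<le> i \<Longrightarrow> i \<le> j \<Longrightarrow> g j \<le> g i" and zero: "g (Suc N) = 0"
  shows "\<exists>mu. is_partition mu \<and> length mu \<le> N \<and> (\<forall>j\<ge>1. part mu j = g j)"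
proof -
  define M where "M = (LEAST m. g (Suc m) = 0)"
  have M0: "g (Suc M) = 0" unfolding M_def using zero by (rule LeastI)
  have MN: "M \<le> N" unfolding M_def using zero by (rule Least_le)
  have pos: "g (Suc m) \<noteq> 0" if "m < M" for m
    using that not_less_Least unfolding M_def by blast
  define mu where "mu = map (\<lambda>m. g (Suc m)) [0..<M]"
  have "sorted_wrt (\<ge>) mu"
    unfolding mu_def sorted_wrt_iff_nth_less by (auto intro!: anti)
  moreover have "0 \<notin> set mu" using pos by (force simp: mu_def)
  ultimately have "is_partition mu" by (simp add: is_partition_def)
  moreover have "part mu j = g j" if "1 \<le> j" for j
  proof (cases "j \<le> M")
    case True
    obtain n where n: "j = Suc n" using \<open>1 \<le> j\<close> by (cases j) auto
    have "n < M" using True n by simp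
    then show ?thesis by (simp add: part_def mu_def n)
  next
    case False
    then have "g j \<le> g (Suc M)" by (intro anti) auto
    then show ?thesis using M0 False by (simp add: part_def mu_def)
  qed
  moreover have "length mu \<le> N" using MN by (simp add: mu_def)
  ultimately show ?thesis by blast
qed

lemma down_closed_eq:
  fixes M :: "nat set"
  assumes "finite M" "0 \<notin> M" "\<And>m. Suc (Suc m) \<in> M \<Longrightarrow> Suc m \<in> M"
  shows "M = {1..card M}"
proof -
  have d: "n \<in> M" if "m \<in> M" "1 \<le> n" "n \<le> m" for m n
    using that(3,1)
  proof (induction rule: inc_induct)
    case (step l)
    have "Suc (Suc (l - 1)) \<in> M" using step that(2) by simp
    then have "Suc (l - 1) \<in> M" by (rule assms(3))
    then show ?case using step that(2) by simp
  qed
  have "\<exists>n. M = {1..n}"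
  proof (cases "M = {}")
    case True
    then have "M = {1..0}" by simp
    then show ?thesis by blast
  next
    case False
    have mx: "Max M \<in> M" using assms(1) False by simp
    have le: "x \<le> Max M" if "x \<in> M" for x using that assms(1) by simp
    have ge: "1 \<le> x" if "x \<in> M" for x using that assms(2) by (cases x) auto
    have "M \<subseteq> {1..Max M}" using le ge by (meson atLeastAtMost_iff subsetI)
    moreover have "{1..Max M} \<subseteq> M" using d[OF mx] by (meson atLeastAtMost_iff subsetI)
    ultimately show ?thesis by blast
  qed
  then obtain n where "M = {1..n}" by blast
  then show ?thesis by simp
qed

lemma diag_set:
  "{A \<in> S. content A = x} =
   (\<lambda>m. (m + nat (- x), m + nat x)) ` {m. (m + nat (- x), m + nat x) \<in> S}" (is "?L = ?R")
proof
  show "?R \<subseteq> ?L" by (auto simp: content_def)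
  show "?L \<subseteq> ?R"
  proof
    fix A assume A: "A \<in> ?L"
    obtain r c where rc: "A = (r, c)" by (cases A)
    have "A = (min r c + nat (- x), min r c + nat x)"
      using A by (auto simp: rc content_def min_def)
    then show "A \<in> ?R" using A by blast
  qed
qed

lemma card_diag_set:
  "card {A \<in> S. content A = x} = card {m. (m + nat (- x), m + nat x) \<in> S}"
  unfolding diag_set by (rule card_image) (auto simp: inj_on_def)

lemma finite_young:
  assumes "is_partition la"
  shows "finite (young la)"
proof (rule finite_subset)
  show "young la \<subseteq> {1..length la} \<times> {1..part la 1}"
  proof
    fix A assume A: "A \<in> young la"
    obtain r c where rc: "A = (r, c)" by (cases A)
    have "part la r \<le> part la 1" "r \<le> length la"
      using A part_antimono[OF assms, of 1 r] part_pos_iff[OF assms, of r]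
      by (auto simp: young_def rc)
    then show "A \<in> {1..length la} \<times> {1..part la 1}" using A by (auto simp: young_def rc)
  qed
qed simp

lemma young_down:
  assumes "is_partition la" "(r, c) \<in> young la" "1 \<le> r'" "r' \<le> r" "1 \<le> c'" "c' \<le> c"
  shows "(r', c') \<in> young la"
proof -
  have "c \<le> part la r" using assms(2) by (simp add: young_def)
  also have "part la r \<le> part la r'" by (rule part_antimono) (fact assms)+
  finally have "c' \<le> part la r'" using assms(6) by (rule le_trans[rotated])
  then show ?thesis using assms(3,5) by (simp add: young_def)
qed

lemma young_iff_diag:
  assumes "is_partition la" "1 \<le> r" "1 \<le> c"
  shows "(r, c) \<in> young la \<longleftrightarrow> min r c \<le> diag la (int c - int r)"
proof -
  define x where "x = int c - int r"
  define M where "M = {m. (m + nat (- x), m + nat x) \<in> young la}"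
  have "inj_on (\<lambda>m. (m + nat (- x), m + nat x)) M" by (auto simp: inj_on_def)
  moreover have "finite ((\<lambda>m. (m + nat (- x), m + nat x)) ` M)"
    by (rule finite_subset[OF _ finite_young[OF assms(1)]]) (auto simp: M_def)
  ultimately have "finite M" using finite_imageD by blast
  moreover have "0 \<notin> M"
    by (cases "x \<ge> 0") (simp_all add: M_def young_def)
  moreover have "Suc m \<in> M" if "Suc (Suc m) \<in> M" for m
    using that unfolding M_def mem_Collect_eq by (rule young_down[OF assms(1)]) auto
  ultimately have "M = {1..card M}" using down_closed_eq by blast
  then have "M = {1..diag la x}" unfolding M_def diag_def card_diag_set .
  then have "min r c \<in> M \<longleftrightarrow> min r c \<le> diag la x" using assms by auto
  moreover have "(min r c + nat (- x), min r c + nat x) = (r, c)"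
    by (auto simp: x_def min_def)
  ultimately show ?thesis by (simp add: M_def x_def)
qed

lemma young_diag_node:
  assumes "is_partition la" "1 \<le> m"
  shows "(m + nat (- x), m + nat x) \<in> young la \<longleftrightarrow> m \<le> diag la x"
proof -
  have "min (m + nat (- x)) (m + nat x) = m" by simp
  moreover have "int (m + nat x) - int (m + nat (- x)) = x" by simp
  ultimately show ?thesis
    using young_iff_diag[OF assms(1), of "m + nat (- x)" "m + nat x"] assms(2) by simp
qed

lemma young_diag_Suc:
  assumes "is_partition la"
  shows "(Suc m + nat (- x), Suc m + nat x) \<in> young la \<longleftrightarrow> Suc m \<le> diag la x"
  using assms by (rule young_diag_node) simp

lemma diag_inject:
  assumes "is_partition la" "is_partition mu" "\<And>x. diag la x = diag mu x"
  shows "la = mu"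
proof -
  have y: "(r, c) \<in> young la \<longleftrightarrow> (r, c) \<in> young mu" if "1 \<le> r" "1 \<le> c" for r c
    using young_iff_diag[OF assms(1) that] young_iff_diag[OF assms(2) that] assms(3) by simp
  show ?thesis
  proof (rule partition_eqI[OF assms(1,2)])
    fix j :: nat assume j: "1 \<le> j"
    have "c \<le> part la j \<longleftrightarrow> c \<le> part mu j" for c
      using y[OF j, of c] j by (cases "c = 0") (auto simp: young_def)
    then show "part la j = part mu j" by (meson le_antisym le_refl)
  qed
qed

lemma diag_step_right:
  assumes "is_partition la" "0 \<le> x"
  shows "diag la (x + 1) \<le> diag la x" "diag la x \<le> diag la (x + 1) + 1"
proof -
  show "diag la (x + 1) \<le> diag la x"
  proof (cases "diag la (x + 1)")
    case (Suc m)
    then have "(Suc m + nat (- (x + 1)), Suc m + nat (x + 1)) \<in> young la"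
      unfolding young_diag_Suc[OF assms(1)] by simp
    then have "(Suc m + nat (- x), Suc m + nat x) \<in> young la"
      by (rule young_down[OF assms(1)]) (use assms(2) in auto)
    then show ?thesis unfolding young_diag_Suc[OF assms(1)] using Suc by simp
  qed simp
  show "diag la x \<le> diag la (x + 1) + 1"
  proof (cases "diag la x \<le> 1")
    case False
    then obtain m where m: "diag la x = Suc (Suc m)"
      by (metis One_nat_def not0_implies_Suc le_refl zero_le)
    then have "(Suc (Suc m) + nat (- x), Suc (Suc m) + nat x) \<in> young la"
      unfolding young_diag_Suc[OF assms(1)] by simp
    then have "(Suc m + nat (- (x + 1)), Suc m + nat (x + 1)) \<in> young la"
      by (rule young_down[OF assms(1)]) (use assms(2) in auto)
    then show ?thesis unfolding young_diag_Suc[OF assms(1)] using m by simp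
  qed simp
qed

lemma diag_step_left:
  assumes "is_partition la" "x < 0"
  shows "diag la x \<le> diag la (x + 1)" "diag la (x + 1) \<le> diag la x + 1"
proof -
  show "diag la x \<le> diag la (x + 1)"
  proof (cases "diag la x")
    case (Suc m)
    then have "(Suc m + nat (- x), Suc m + nat x) \<in> young la"
      unfolding young_diag_Suc[OF assms(1)] by simp
    then have "(Suc m + nat (- (x + 1)), Suc m + nat (x + 1)) \<in> young la"
      by (rule young_down[OF assms(1)]) (use assms(2) in auto)
    then show ?thesis unfolding young_diag_Suc[OF assms(1)] using Suc by simp
  qed simp
  show "diag la (x + 1) \<le> diag la x + 1"
  proof (cases "diag la (x + 1) \<le> 1")
    case False
    then obtain m where m: "diag la (x + 1) = Suc (Suc m)"
      by (metis One_nat_def not0_implies_Suc le_refl zero_le)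
    then have "(Suc (Suc m) + nat (- (x + 1)), Suc (Suc m) + nat (x + 1)) \<in> young la"
      unfolding young_diag_Suc[OF assms(1)] by simp
    then have "(Suc m + nat (- x), Suc m + nat x) \<in> young la"
      by (rule young_down[OF assms(1)]) (use assms(2) in auto)
    then show ?thesis unfolding young_diag_Suc[OF assms(1)] using m by simp
  qed simp
qed

lemma diag_eq_0:
  assumes "is_partition la" "int (length la + part la 1) \<le> \<bar>x\<bar>"
  shows "diag la x = 0"
proof (rule ccontr)
  assume "diag la x \<noteq> 0"
  then have "(1 + nat (- x), 1 + nat x) \<in> young la"
    using young_diag_node[OF assms(1), of 1 x] by simp
  then have y: "1 + nat x \<le> part la (1 + nat (- x))" by (simp add: young_def)
  also have "\<dots> \<le> part la 1" using assms(1) by (rule part_antimono) auto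
  finally have "1 + nat x \<le> part la 1" .
  moreover have "1 + nat (- x) \<le> length la"
    using y part_pos_iff[OF assms(1), of "1 + nat (- x)"] by linarith
  ultimately show False using assms(2) by linarith
qed

lemma ex_diag:
  fixes f :: "int \<Rightarrow> nat"
  assumes right: "\<And>x. 0 \<le> x \<Longrightarrow> f (x + 1) \<le> f x" "\<And>x. 0 \<le> x \<Longrightarrow> f x \<le> f (x + 1) + 1"
    and left: "\<And>x. x < 0 \<Longrightarrow> f x \<le> f (x + 1)" "\<And>x. x < 0 \<Longrightarrow> f (x + 1) \<le> f x + 1"
    and fin: "\<And>x. int N \<le> \<bar>x\<bar> \<Longrightarrow> f x = 0"
  shows "\<exists>mu. is_partition mu \<and> (\<forall>x. diag mu x = f x)"
proof -
  define S where "S = {(r, c). 1 \<le> r \<and> 1 \<le> c \<and> min r c \<le> f (int c - int r)}"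
  have col: "(r, Suc c) \<in> S" if "(r, Suc (Suc c)) \<in> S" for r c
  proof -
    have eq: "int (Suc (Suc c)) - int r = (int (Suc c) - int r) + 1" by simp
    have h: "1 \<le> r" "min r (Suc (Suc c)) \<le> f ((int (Suc c) - int r) + 1)"
      using that unfolding S_def mem_Collect_eq prod.case eq by auto
    have "min r (Suc c) \<le> f (int (Suc c) - int r)"
    proof (cases "r \<le> Suc c")
      case True
      then have "0 \<le> int (Suc c) - int r" by simp
      from right(1)[OF this] h True show ?thesis by simp
    next
      case False
      then have "int (Suc c) - int r < 0" by simp
      from left(2)[OF this] h False show ?thesis by simp
    qed
    then show ?thesis using h by (simp add: S_def)
  qed
  have row: "(Suc r, c) \<in> S" if "(Suc (Suc r), c) \<in> S" for r c
  proof -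
    have eq: "int c - int (Suc r) = (int c - int (Suc (Suc r))) + 1" by simp
    have h: "1 \<le> c" "min (Suc (Suc r)) c \<le> f (int c - int (Suc (Suc r)))"
      using that unfolding S_def mem_Collect_eq prod.case by auto
    have "min (Suc r) c \<le> f ((int c - int (Suc (Suc r))) + 1)"
    proof (cases "Suc (Suc r) \<le> c")
      case True
      then have "0 \<le> int c - int (Suc (Suc r))" by simp
      from right(2)[OF this] h True show ?thesis by simp
    next
      case False
      then have "int c - int (Suc (Suc r)) < 0" by simp
      from left(1)[OF this] h False show ?thesis by simp
    qed
    then show ?thesis using h unfolding S_def mem_Collect_eq prod.case eq by simp
  qed
  define g where "g r = card {c. (r, c) \<in> S}" for r
  have g: "{c. (r, c) \<in> S} = {1..g r}" for r
    unfolding g_def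
  proof (rule down_closed_eq)
    have "{c. (r, c) \<in> S} \<subseteq> {..r + N}"
    proof
      fix c assume "c \<in> {c. (r, c) \<in> S}"
      then have "f (int c - int r) \<noteq> 0" by (auto simp: S_def)
      then have "\<not> int N \<le> \<bar>int c - int r\<bar>"
        using fin[of "int c - int r"] by metis
      then show "c \<in> {..r + N}" by simp
    qed
    then show "finite {c. (r, c) \<in> S}" by (rule finite_subset) simp
    show "0 \<notin> {c. (r, c) \<in> S}" by (simp add: S_def)
    show "Suc m \<in> {c. (r, c) \<in> S}" if "Suc (Suc m) \<in> {c. (r, c) \<in> S}" for m
      using that col by simp
  qed
  have gstep: "g (Suc (Suc r)) \<le> g (Suc r)" for r
  proof -
    have "{1..g (Suc (Suc r))} \<subseteq> {1..g (Suc r)}"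
      unfolding g[symmetric] using row by blast
    from card_mono[OF _ this] show ?thesis by simp
  qed
  have anti: "g j \<le> g i" if "1 \<le> i" "i \<le> j" for i j
    using that(2)
  proof (induction rule: dec_induct)
    case (step n)
    obtain m where "n = Suc m" using step(1) \<open>1 \<le> i\<close> by (cases n) auto
    then show ?case using step gstep[of m] by simp
  qed simp
  have "\<not> 1 \<le> g (Suc N)"
  proof
    assume "1 \<le> g (Suc N)"
    then have "(Suc N, 1) \<in> S" using g[of "Suc N"] by (simp add: set_eq_iff)
    then have "f (1 - int (Suc N)) \<noteq> 0" by (simp add: S_def)
    then show False using fin[of "1 - int (Suc N)"] by simp
  qed
  then have zero: "g (Suc N) = 0" by simp
  obtain mu where mu: "is_partition mu" "\<And>j. 1 \<le> j \<Longrightarrow> part mu j = g j"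
    using ex_partition[of g N, OF anti zero] by blast
  have yS: "(r, c) \<in> young mu \<longleftrightarrow> (r, c) \<in> S" for r c
  proof (cases "1 \<le> r")
    case True
    have "(r, c) \<in> S \<longleftrightarrow> c \<in> {1..g r}" using g[of r] by blast
    then show ?thesis using True mu(2)[OF True] by (simp add: young_def)
  next
    case False
    then show ?thesis by (simp add: young_def S_def)
  qed
  have "diag mu x = f x" for x
  proof -
    have "{m. (m + nat (- x), m + nat x) \<in> young mu} = {1..f x}"
    proof (rule set_eqI)
      fix m
      have i: "int (m + nat x) - int (m + nat (- x)) = x" by simp
      have j: "min (m + nat (- x)) (m + nat x) = m" by simp
      have "(m + nat (- x), m + nat x) \<in> young mu \<longleftrightarrow>
          1 \<le> m + nat (- x) \<and> 1 \<le> m + nat x \<and> m \<le> f x"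
        unfolding yS S_def mem_Collect_eq prod.case i j ..
      moreover have "1 \<le> m + nat (- x) \<and> 1 \<le> m + nat x \<longleftrightarrow> 1 \<le> m" by linarith
      ultimately show "m \<in> {m. (m + nat (- x), m + nat x) \<in> young mu} \<longleftrightarrow> m \<in> {1..f x}"
        unfolding mem_Collect_eq atLeastAtMost_iff by argo
    qed
    then show ?thesis unfolding diag_def card_diag_set by simp
  qed
  then show ?thesis using mu(1) by blast
qed

lemma new_content_step:
  "new_content e k i (c + 1) = new_content e k i c + 1 + (if k_diagonal e k i c then 1 else 0)"
proof (cases "0 \<le> c")
  case True
  have "{b. 0 \<le> b \<and> b + 1 \<le> c + 1 \<and> k_diagonal e k i b} =
      (if k_diagonal e k i c then {c} else {}) \<union> {b. 0 \<le> b \<and> b + 1 \<le> c \<and> k_diagonal e k i b}"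
    using True by (auto simp: le_less)
  moreover have "finite {b. 0 \<le> b \<and> b + 1 \<le> c \<and> k_diagonal e k i b}"
    by (rule finite_subset[of _ "{0..c}"]) auto
  ultimately have s: "card {b. 0 \<le> b \<and> b + 1 \<le> c + 1 \<and> k_diagonal e k i b} =
      (if k_diagonal e k i c then 1 else 0) + card {b. 0 \<le> b \<and> b + 1 \<le> c \<and> k_diagonal e k i b}"
    by simp
  have z: "{b. b < 0 \<and> c \<le> b \<and> k_diagonal e k i b} = {}"
    "{b. b < 0 \<and> c + 1 \<le> b \<and> k_diagonal e k i b} = {}"
    using True by auto
  show ?thesis unfolding new_content_def s z by simp
next
  case False
  have "{b. b < 0 \<and> c \<le> b \<and> k_diagonal e k i b} =
      (if k_diagonal e k i c then {c} else {}) \<union> {b. b < 0 \<and> c + 1 \<le> b \<and> k_diagonal e k i b}"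
    using False by (auto simp: le_less)
  moreover have "finite {b. b < 0 \<and> c + 1 \<le> b \<and> k_diagonal e k i b}"
    by (rule finite_subset[of _ "{c..0}"]) auto
  ultimately have s: "card {b. b < 0 \<and> c \<le> b \<and> k_diagonal e k i b} =
      (if k_diagonal e k i c then 1 else 0) + card {b. b < 0 \<and> c + 1 \<le> b \<and> k_diagonal e k i b}"
    by simp
  have z: "{b. 0 \<le> b \<and> b + 1 \<le> c \<and> k_diagonal e k i b} = {}"
    "{b. 0 \<le> b \<and> b + 1 \<le> c + 1 \<and> k_diagonal e k i b} = {}"
    using False by auto
  show ?thesis unfolding new_content_def s z by simp
qed

lemma new_content_0: "new_content e k i 0 = 0"
proof -
  have "{b. 0 \<le> b \<and> b + 1 \<le> (0::int) \<and> k_diagonal e k i b} = {}"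
    "{b. b < 0 \<and> (0::int) \<le> b \<and> k_diagonal e k i b} = {}" by auto
  then show ?thesis unfolding new_content_def by (metis add_0 card.empty diff_0_right of_nat_0)
qed

lemma new_content_mono:
  assumes "c \<le> c'"
  shows "new_content e k i c \<le> new_content e k i c'"
  using assms
proof (induction rule: int_ge_induct)
  case (step x)
  then show ?case using new_content_step[of e k i x] by simp
qed simp

lemma new_content_cover:
  "\<exists>c. new_content e k i c \<le> z \<and> z < new_content e k i (c + 1)"
proof (induction z rule: int_induct[where k = 0])
  case base
  have "new_content e k i (0 + 1) \<ge> 1"
    using new_content_step[of e k i 0] new_content_0[of e k i] by simp
  then show ?case using new_content_0[of e k i] by (intro exI[of _ 0]) linarith
next
  case (step1 z)
  then obtain c where c: "new_content e k i c \<le> z" "z < new_content e k i (c + 1)" by blast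
  show ?case
  proof (cases "z + 1 < new_content e k i (c + 1)")
    case True
    then show ?thesis using c by (intro exI[of _ c]) linarith
  next
    case False
    then show ?thesis using c new_content_step[of e k i "c + 1"]
      by (intro exI[of _ "c + 1"]) (simp split: if_splits)
  qed
next
  case (step2 z)
  then obtain c where c: "new_content e k i c \<le> z" "z < new_content e k i (c + 1)" by blast
  show ?case
  proof (cases "new_content e k i c \<le> z - 1")
    case True
    then show ?thesis using c by (intro exI[of _ c]) linarith
  next
    case False
    then show ?thesis using c new_content_step[of e k i "c - 1"]
      by (intro exI[of _ "c - 1"]) (simp split: if_splits)
  qed
qed

lemma new_content_cover_unique:
  assumes "new_content e k i c \<le> z" "z < new_content e k i (c + 1)"
    "new_content e k i c' \<le> z" "z < new_content e k i (c' + 1)"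
  shows "c = c'"
proof (rule ccontr)
  assume "c \<noteq> c'"
  then have "c + 1 \<le> c' \<or> c' + 1 \<le> c" by linarith
  then show False
    using assms new_content_mono[of "c + 1" c' e k i] new_content_mono[of "c' + 1" c e k i] by linarith
qed

theorem Phi_Y_well_defined:
  assumes la: "is_partition la"
  shows "\<exists>!mu. is_partition mu \<and>
     (\<forall>c. diag mu (new_content e k i c) = diag la c) \<and>
     (\<forall>b. k_diagonal e k i b \<longrightarrow> diag mu (new_content e k i b + 1) = diag la b)"
proof (rule ex_ex1I)
  let ?n = "new_content e k i"
  define h where "h z = (SOME c. ?n c \<le> z \<and> z < ?n (c + 1))" for z
  have h: "?n (h z) \<le> z" "z < ?n (h z + 1)" for z
    using someI_ex[OF new_content_cover, of e k i z] unfolding h_def by auto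
  have h_eq: "h z = c" if "?n c \<le> z" "z < ?n (c + 1)" for z c
    using new_content_cover_unique[OF h that] .
  have h_old: "h (?n c) = c" for c
    by (rule h_eq) (auto simp: new_content_step)
  have h_new: "h (?n b + 1) = b" if "k_diagonal e k i b" for b
    by (rule h_eq) (use that in \<open>auto simp: new_content_step\<close>)
  have h_step: "h (z + 1) = h z \<or> h (z + 1) = h z + 1" for z
  proof (cases "z + 1 < ?n (h z + 1)")
    case True
    then show ?thesis using h[of z] h_eq[of "h z" "z + 1"] by simp
  next
    case False
    then have "h (z + 1) = h z + 1"
      using h[of z] new_content_step[of e k i "h z + 1"] by (intro h_eq) (simp_all split: if_splits)
    then show ?thesis ..
  qed
  have h_ge: "c \<le> h z" if "?n c \<le> z" for c z
  proof (rule ccontr)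
    assume "\<not> c \<le> h z"
    then have "?n (h z + 1) \<le> ?n c" by (intro new_content_mono) simp
    then show False using h(2)[of z] that by simp
  qed
  have h_le: "h z < c" if "z < ?n c" for c z
  proof (rule ccontr)
    assume "\<not> h z < c"
    then have "?n c \<le> ?n (h z)" by (intro new_content_mono) simp
    then show False using h(1)[of z] that by simp
  qed
  define N where "N = int (length la + part la 1)"
  have "\<exists>mu. is_partition mu \<and> (\<forall>x. diag mu x = diag la (h x))"
  proof (rule ex_diag)
    fix x :: int
    have ge: "0 \<le> h x" if "0 \<le> x" using h_ge[of 0 x] that by (simp add: new_content_0)
    show "diag la (h (x + 1)) \<le> diag la (h x)" "diag la (h x) \<le> diag la (h (x + 1)) + 1"
      if "0 \<le> x"
      using h_step[of x] diag_step_right[OF la ge[OF that]] by auto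
    have lt: "h x < 0" if "x < 0" using h_le[of x 0] that by (simp add: new_content_0)
    show "diag la (h x) \<le> diag la (h (x + 1))" "diag la (h (x + 1)) \<le> diag la (h x) + 1"
      if "x < 0"
      using h_step[of x] diag_step_left[OF la lt[OF that]] by auto
    show "diag la (h x) = 0" if "int (nat (max (?n N) (1 - ?n (- N)))) \<le> \<bar>x\<bar>"
    proof (rule diag_eq_0[OF la])
      have "?n N \<le> x \<or> x < ?n (- N)" using that by linarith
      then have "N \<le> h x \<or> h x < - N" using h_ge h_le by blast
      then show "int (length la + part la 1) \<le> \<bar>h x\<bar>" unfolding N_def by linarith
    qed
  qed
  then obtain mu where mu: "is_partition mu" "\<And>x. diag mu x = diag la (h x)" by blast
  show "\<exists>mu. is_partition mu \<and> (\<forall>c. diag mu (?n c) = diag la c) \<and>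
     (\<forall>b. k_diagonal e k i b \<longrightarrow> diag mu (?n b + 1) = diag la b)"
    using mu h_old h_new by (intro exI[of _ mu]) simp
next
  let ?n = "new_content e k i"
  fix mu nu
  assume mu: "is_partition mu \<and> (\<forall>c. diag mu (?n c) = diag la c) \<and>
     (\<forall>b. k_diagonal e k i b \<longrightarrow> diag mu (?n b + 1) = diag la b)"
    and nu: "is_partition nu \<and> (\<forall>c. diag nu (?n c) = diag la c) \<and>
     (\<forall>b. k_diagonal e k i b \<longrightarrow> diag nu (?n b + 1) = diag la b)"
  show "mu = nu"
  proof (rule diag_inject)
    fix x
    obtain c where c: "?n c \<le> x" "x < ?n (c + 1)" using new_content_cover by blast
    then have "x = ?n c \<or> k_diagonal e k i c \<and> x = ?n c + 1"
      by (auto simp: new_content_step split: if_splits)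
    then show "diag mu x = diag nu x" using mu nu by auto
  qed (use mu nu in auto)
qed

lemma beta_set_eq:
  "beta_set mu (int n) = (\<lambda>p. int (part mu (n - p)) + int p) ` {..<n}"
proof
  show "beta_set mu (int n) \<subseteq> (\<lambda>p. int (part mu (n - p)) + int p) ` {..<n}"
  proof
    fix z assume "z \<in> beta_set mu (int n)"
    then obtain j where j: "z = int (part mu j) - int j + int n" "1 \<le> j" "int j \<le> int n"
      unfolding beta_set_def by blast
    then have "n - (n - j) = j" "n - j < n" "int (n - j) = int n - int j" by auto
    then show "z \<in> (\<lambda>p. int (part mu (n - p)) + int p) ` {..<n}"
      using j(1) by (intro image_eqI[of _ _ "n - j"]) auto
  qed
  show "(\<lambda>p. int (part mu (n - p)) + int p) ` {..<n} \<subseteq> beta_set mu (int n)"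
  proof
    fix z assume "z \<in> (\<lambda>p. int (part mu (n - p)) + int p) ` {..<n}"
    then obtain p where "p < n" "z = int (part mu (n - p)) + int p" by blast
    then show "z \<in> beta_set mu (int n)"
      unfolding beta_set_def mem_Collect_eq by (intro exI[of _ "n - p"]) auto
  qed
qed

lemma beta_list:
  assumes "is_partition mu"
  shows "sorted_list_of_set (beta_set mu (int n)) =
    map (\<lambda>p. int (part mu (n - p)) + int p) [0..<n]" (is "_ = ?xs")
proof -
  have "sorted_wrt (<) ?xs"
    unfolding sorted_wrt_iff_nth_less
  proof (intro allI impI)
    fix p q assume pq: "p < q" "q < length ?xs"
    then have "part mu (n - p) \<le> part mu (n - q)" by (intro part_antimono[OF assms]) auto
    then show "?xs ! p < ?xs ! q" using pq by simp
  qed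
  moreover have "set ?xs = beta_set mu (int n)"
    unfolding beta_set_eq by (simp add: lessThan_atLeast0)
  ultimately show ?thesis
    by (metis sorted_list_of_set.idem_if_sorted_distinct strict_sorted_iff)
qed

lemma beta_set_inject:
  assumes "is_partition mu" "is_partition nu" "length mu \<le> n" "length nu \<le> n"
    "beta_set mu (int n) = beta_set nu (int n)"
  shows "mu = nu"
proof (rule partition_eqI[OF assms(1,2)])
  fix j :: nat assume j: "1 \<le> j"
  show "part mu j = part nu j"
  proof (cases "j \<le> n")
    case True
    have "map (\<lambda>p. int (part mu (n - p)) + int p) [0..<n] =
        map (\<lambda>p. int (part nu (n - p)) + int p) [0..<n]"
      using beta_list[OF assms(1), of n] beta_list[OF assms(2), of n] assms(5) by simp
    then have "\<forall>p<n. part mu (n - p) = part nu (n - p)" by simp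
    moreover have "n - j < n" using True j by linarith
    ultimately have "part mu (n - (n - j)) = part nu (n - (n - j))" by blast
    then show ?thesis using True by simp
  next
    case False
    then show ?thesis using assms(3,4) by (simp add: part_def)
  qed
qed

lemma ex_beta_set:
  fixes B :: "int set"
  assumes "finite B" "\<And>z. z \<in> B \<Longrightarrow> 0 \<le> z"
  shows "\<exists>mu. is_partition mu \<and> length mu \<le> card B \<and> beta_set mu (int (card B)) = B"
proof -
  define n where "n = card B"
  define ys where "ys = sorted_list_of_set B"
  have ys: "length ys = n" "set ys = B" "sorted_wrt (<) ys"
    using assms(1) by (auto simp: ys_def n_def)
  have gap: "ys ! p + int (q - p) \<le> ys ! q" if "p \<le> q" "q < n" for p q
    using that
  proof (induction q rule: dec_induct)
    case (step m)
    have "ys ! m < ys ! Suc m"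
      using sorted_wrt_nth_less[OF ys(3), of m "Suc m"] step ys(1) by simp
    then show ?case using step by (simp add: Suc_diff_le)
  qed simp
  have low: "int q \<le> ys ! q" if "q < n" for q
  proof -
    have "ys ! 0 \<in> B" using ys that by (metis gr_implies_not0 nth_mem gr0I)
    then show ?thesis using gap[of 0 q] that assms(2)[of "ys ! 0"] by simp
  qed
  define g where "g j = (if j \<le> n then nat (ys ! (n - j) - int (n - j)) else 0)" for j
  have "\<exists>mu. is_partition mu \<and> length mu \<le> n \<and> (\<forall>j\<ge>1. part mu j = g j)"
  proof (rule ex_partition)
    fix i j :: nat assume ij: "1 \<le> i" "i \<le> j"
    show "g j \<le> g i"
    proof (cases "j \<le> n")
      case True
      then have "ys ! (n - j) + int (n - i - (n - j)) \<le> ys ! (n - i)"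
        using ij by (intro gap) auto
      then show ?thesis using True ij by (auto simp: g_def intro!: nat_mono)
    qed (simp add: g_def)
  qed (simp add: g_def)
  then obtain mu where mu: "is_partition mu" "length mu \<le> n" "\<And>j. 1 \<le> j \<Longrightarrow> part mu j = g j"
    by blast
  have "int (part mu (n - p)) + int p = ys ! p" if "p < n" for p
    using that low[of p] mu(3)[of "n - p"] by (simp add: g_def)
  then have "beta_set mu (int n) = (\<lambda>p. ys ! p) ` {..<n}" unfolding beta_set_eq by simp
  also have "\<dots> = set ys" using ys(1) by (auto simp: set_conv_nth)
  finally show ?thesis using mu ys(2) unfolding n_def by blast
qed

lemma position_inj:
  assumes "0 < e"
  shows "inj_on (\<lambda>(q, b). q * e + b) {(q :: int, b). 0 \<le> b \<and> b < e}"
proof (rule inj_onI)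
  fix x y :: "int \<times> int"
  assume xy: "x \<in> {(q, b). 0 \<le> b \<and> b < e}" "y \<in> {(q, b). 0 \<le> b \<and> b < e}"
    "(case x of (q, b) \<Rightarrow> q * e + b) = (case y of (q, b) \<Rightarrow> q * e + b)"
  obtain q b q' b' where p: "x = (q, b)" "y = (q', b')" by (cases x, cases y)
  have "q * e + b = q' * e + b'" using xy(3) p by simp
  moreover have "(q * e + b) div e = q" "(q' * e + b') div e = q'"
    using xy(1,2) p assms by simp_all
  ultimately have "q = q'" by metis
  then show "x = y" using xy(3) p by simp
qed

theorem Phi_A_well_defined:
  assumes la: "is_partition la" and e: "0 < e" and k: "0 \<le> k" "k < e"
    and datum: "abacus_datum e k i la (a, c, d, a')"
  shows "\<exists>!mu. is_partition mu \<and> int (length mu) \<le> a' \<and>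
     beta_set mu a' = bead_positions (e + 1) (insert_runner k c (abacus e la a))"
proof -
  have D: "k \<le> a" "0 \<le> d" "a + d = c * e + k" "a' = a + c"
    using datum by (auto simp: abacus_datum_def)
  have "0 \<le> c * e" using D by linarith
  then have c: "0 \<le> c" using e by (simp add: zero_le_mult_iff)
  have a: "0 \<le> a" "int (nat a) = a" using k D by auto
  define X where "X = abacus e la a"
  have Xb: "0 \<le> q" "0 \<le> b" "b < e" if "(q, b) \<in> X" for q b
    using that by (auto simp: X_def abacus_def)
  have inj: "inj_on (\<lambda>(q, b). q * e + b) X"
    by (rule inj_on_subset[OF position_inj[OF e]]) (auto dest: Xb)
  have beta: "beta_set la a = (\<lambda>p. int (part la (nat a - p)) + int p) ` {..<nat a}"
    using beta_set_eq[of la "nat a"] a by simp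
  have img: "(\<lambda>(q, b). q * e + b) ` X = beta_set la a"
  proof
    show "(\<lambda>(q, b). q * e + b) ` X \<subseteq> beta_set la a" by (auto simp: X_def abacus_def)
    show "beta_set la a \<subseteq> (\<lambda>(q, b). q * e + b) ` X"
    proof
      fix z assume z: "z \<in> beta_set la a"
      then have "0 \<le> z" unfolding beta by auto
      then have "(z div e, z mod e) \<in> X"
        using z e by (simp add: X_def abacus_def pos_imp_zdiv_nonneg_iff)
      then show "z \<in> (\<lambda>(q, b). q * e + b) ` X" by (rule image_eqI[rotated]) simp
    qed
  qed
  have "finite (beta_set la a)" unfolding beta by simp
  then have finX: "finite X" using inj unfolding img[symmetric] by (rule finite_imageD)
  have "card (beta_set la a) = length (sorted_list_of_set (beta_set la (int (nat a))))"
    using a by simp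
  also have "\<dots> = nat a" unfolding beta_list[OF la] by simp
  finally have cardX: "card X = nat a" using card_image[OF inj] img by simp
  define T :: "int \<times> int \<Rightarrow> int \<times> int" where "T = (\<lambda>(q, b). (q, if b < k then b else b + 1))"
  define R where "R = (\<lambda>q. (q, k)) ` {0..<c}"
  have ins: "insert_runner k c X = T ` X \<union> R"
  proof
    show "insert_runner k c X \<subseteq> T ` X \<union> R"
      unfolding insert_runner_def T_def R_def by (fastforce simp: image_iff)
    show "T ` X \<union> R \<subseteq> insert_runner k c X"
      unfolding insert_runner_def T_def R_def by (auto split: if_splits)
  qed
  have "inj_on T X" by (auto simp: inj_on_def T_def split: if_splits)
  then have "card (T ` X) = nat a" using cardX by (simp add: card_image)
  moreover have "card R = nat c" unfolding R_def by (subst card_image) (auto simp: inj_on_def)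
  moreover have "T ` X \<inter> R = {}" by (auto simp: T_def R_def split: if_splits)
  moreover have finI: "finite (T ` X)" "finite R" using finX by (auto simp: R_def)
  ultimately have cardI: "card (insert_runner k c X) = nat a + nat c"
    unfolding ins by (simp add: card_Un_disjoint)
  have Ib: "0 \<le> q" "0 \<le> b" "b < e + 1" if "(q, b) \<in> insert_runner k c X" for q b
    using that k by (auto simp: insert_runner_def dest: Xb)
  define B where "B = bead_positions (e + 1) (insert_runner k c X)"
  have B: "B = (\<lambda>(q, b). q * (e + 1) + b) ` insert_runner k c X"
    unfolding B_def bead_positions_def by force
  have "inj_on (\<lambda>(q, b). q * (e + 1) + b) (insert_runner k c X)"
    by (rule inj_on_subset[OF position_inj]) (use e in \<open>auto dest: Ib\<close>)
  then have cardB: "card B = nat a + nat c" unfolding B by (simp add: card_image cardI)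
  have finB: "finite B" unfolding B ins using finI by simp
  have posB: "0 \<le> z" if "z \<in> B" for z
    using that Ib e unfolding B by auto
  have a': "a' = int (card B)" using cardB D(4) a c by simp
  show ?thesis
    unfolding X_def[symmetric] B_def[symmetric] a'
  proof (rule ex_ex1I)
    show "\<exists>mu. is_partition mu \<and> int (length mu) \<le> int (card B) \<and> beta_set mu (int (card B)) = B"
      using ex_beta_set[OF finB posB] by simp
    show "mu = nu"
      if "is_partition mu \<and> int (length mu) \<le> int (card B) \<and> beta_set mu (int (card B)) = B"
        "is_partition nu \<and> int (length nu) \<le> int (card B) \<and> beta_set nu (int (card B)) = B"
      for mu nu
      using that by (intro beta_set_inject[of mu nu "card B"]) auto
  qed
qed

end

theory Submission
  imports Defs
begin

text \<open>Encode a partition by its Maya diagram, the set of all \<open>part la j - j\<close> with \<open>j \<ge> 1\<close>; a beta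
  set is a shifted truncation of it.  Walking along the rim, the length of the diagonal of content
  \<open>x\<close> exceeds that of content \<open>x + 1\<close> by \<open>[x \<in> maya la] - [x < 0]\<close>, so the diagonal lengths are
  determined by the Maya diagram.  Inserting a runner with \<open>c\<close> beads moves the position \<open>x\<close> of the Maya
  diagram to \<open>new_content e k i x\<close>, or to \<open>new_content e k i x + 1\<close> if \<open>x\<close> is a \<open>k\<close>-diagonal, in
  which case \<open>new_content e k i x\<close> lies on the new runner and is occupied exactly if \<open>x < 0\<close>.
  This leaves the difference between corresponding diagonal lengths constant, hence zero.\<close>

section \<open>Maya diagrams, beta sets and diagonal lengths\<close>

definition maya :: "nat list \<Rightarrow> int set" where
  "maya la = {int (part la j) - int j | j. 1 \<le> j}"

text \<open>The first \<open>a\<close> parts give the shifted beta set. All later parts vanish, so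
  they fill exactly the positions below \<open>- a\<close>.\<close>

lemma maya_iff_beta_set:
  assumes "int (length la) \<le> a"
  shows "x \<in> maya la \<longleftrightarrow> x + a \<in> beta_set la a \<or> x + a < 0"
proof
  assume "x \<in> maya la"
  then obtain j where j: "1 \<le> j" "x = int (part la j) - int j" by (auto simp: maya_def)
  show "x + a \<in> beta_set la a \<or> x + a < 0"
  proof (cases "int j \<le> a")
    case True
    then show ?thesis using j by (auto simp: beta_set_def)
  next
    case False
    then show ?thesis using j assms by (auto simp: part_def)
  qed
next
  assume "x + a \<in> beta_set la a \<or> x + a < 0"
  then show "x \<in> maya la"
  proof
    assume "x + a \<in> beta_set la a"
    then show ?thesis by (auto simp: beta_set_def maya_def)
  next
    assume "x + a < 0"
    then have "part la (nat (- x)) = 0" "1 \<le> nat (- x)" "int (nat (- x)) = - x"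
      using assms by (auto simp: part_def)
    then show ?thesis unfolding maya_def by (intro CollectI exI[of _ "nat (- x)"]) simp
  qed
qed

text \<open>For a nonempty row \<open>j\<close>, \<open>part la j - j = x\<close> says that the row
  ends on the diagonal \<open>x\<close>. The right neighbour of node \<open>m\<close> of that
  diagonal is node \<open>m\<close> of the diagonal \<open>x + 1\<close> if
  \<open>0 \<le> x\<close>, and node \<open>m + 1\<close> if \<open>x < 0\<close>; this shift causes
  the term \<open>of_bool (x < 0)\<close>.\<close>

lemma diag_maya_step:
  assumes la: "is_partition la"
  shows "int (diag la x) = int (diag la (x + 1)) + of_bool (x \<in> maya la) - of_bool (x < 0)"
proof (cases "0 \<le> x")
  case True
  have node: "m + nat x \<le> part la m \<longleftrightarrow> m \<le> diag la x"
    "Suc (m + nat x) \<le> part la m \<longleftrightarrow> m \<le> diag la (x + 1)" if "1 \<le> m" for m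
    using young_diag_node[OF la that, of x] young_diag_node[OF la that, of "x + 1"] True that
    by (simp_all add: young_def nat_add_distrib)
  have "x \<in> maya la \<longleftrightarrow> diag la x = diag la (x + 1) + 1"
  proof
    assume "x \<in> maya la"
    then obtain j where j: "1 \<le> j" "x = int (part la j) - int j" by (auto simp: maya_def)
    then have "part la j = j + nat x" using True by simp
    then have "j \<le> diag la x" "\<not> j \<le> diag la (x + 1)" using node[OF j(1)] by simp_all
    then show "diag la x = diag la (x + 1) + 1" using diag_step_right(2)[OF la True] by simp
  next
    assume "diag la x = diag la (x + 1) + 1"
    then have "part la (diag la x) = diag la x + nat x" "1 \<le> diag la x"
      using node[of "diag la x"] by simp_all
    then show "x \<in> maya la"
      unfolding maya_def using True by (intro CollectI exI[of _ "diag la x"]) simp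
  qed
  then show ?thesis using diag_step_right[OF la True] True by auto
next
  case False
  then have x: "x < 0" by simp
  have node: "m \<le> part la (m + nat (- x)) \<longleftrightarrow> m \<le> diag la x" for m
    using young_diag_node[OF la, of m x] x by (cases "m = 0") (simp_all add: young_def)
  have node': "Suc m \<le> part la (m + nat (- x)) \<longleftrightarrow> Suc m \<le> diag la (x + 1)" for m
  proof -
    have "Suc m + nat (- (x + 1)) = m + nat (- x)" "Suc m + nat (x + 1) = Suc m" using x by simp_all
    then show ?thesis
      using young_diag_Suc[OF la, of m "x + 1"] x
      by (simp only: young_def mem_Collect_eq prod.case) simp
  qed
  have "x \<in> maya la \<longleftrightarrow> diag la x = diag la (x + 1)"
  proof
    assume "x \<in> maya la"
    then obtain j where j: "1 \<le> j" "x = int (part la j) - int j" by (auto simp: maya_def)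
    then have "part la j + nat (- x) = j" using x by simp
    then have "part la j \<le> diag la x" "\<not> Suc (part la j) \<le> diag la (x + 1)"
      using node[of "part la j"] node'[of "part la j"] by simp_all
    then show "diag la x = diag la (x + 1)" using diag_step_left(1)[OF la x] by simp
  next
    assume "diag la x = diag la (x + 1)"
    then have "part la (diag la x + nat (- x)) = diag la x"
      using node[of "diag la x"] node'[of "diag la x"] by simp
    then show "x \<in> maya la"
      unfolding maya_def using x by (intro CollectI exI[of _ "diag la x + nat (- x)"]) simp
  qed
  then show ?thesis using diag_step_left[OF la x] x by auto
qed

section \<open>Closed form and sign of \<open>new_content\<close>\<close>

lemma div_succ_int:
  fixes e y :: int
  assumes "0 < e"
  shows "(y + 1) div e = y div e + of_bool (e dvd y + 1)"
proof -
  have y: "y = e * (y div e) + y mod e" by simp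
  have m: "0 \<le> y mod e" "y mod e < e" using assms by simp_all
  show ?thesis
  proof (cases "y mod e = e - 1")
    case True
    then have eq: "y + 1 = e * (y div e + 1)" using y unfolding distrib_left by linarith
    have "(y + 1) div e = y div e + 1" using assms by (subst eq) simp
    moreover have "e dvd y + 1" by (subst eq) simp
    ultimately show ?thesis by simp
  next
    case False
    then have r: "0 \<le> y mod e + 1" "y mod e + 1 < e" using m by linarith+
    have eq: "y + 1 = e * (y div e) + (y mod e + 1)" using y by linarith
    have "(y + 1) div e = y div e" by (rule int_div_pos_eq[OF eq r])
    moreover have "(y + 1) mod e = y mod e + 1" by (rule int_mod_pos_eq[OF eq r])
    then have "\<not> e dvd y + 1" using m(1) by (simp add: dvd_eq_mod_eq_0)
    ultimately show ?thesis by simp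
  qed
qed

text \<open>The quotient \<open>(x + i - k - 1) div e\<close> jumps by one from \<open>x\<close> to
  \<open>x + 1\<close> exactly when \<open>x\<close> is a \<open>k\<close>-diagonal, so both sides
  have equal increments; subtracting its value at 0 makes them agree there.\<close>

lemma new_content_eq:
  assumes "0 \<le> k" "k < e"
  shows "new_content e k i x = x + (x + i - k - 1) div e - (i - k - 1) div e"
proof -
  have step: "new_content e k i (y + 1) - (y + 1 + i - k - 1) div e =
      new_content e k i y + 1 - (y + i - k - 1) div e" for y
  proof -
    have "k_diagonal e k i y \<longleftrightarrow> (i + y) mod e = k mod e" using assms by (simp add: k_diagonal_def)
    also have "\<dots> \<longleftrightarrow> e dvd (y + i - k - 1) + 1"
      by (simp add: mod_eq_dvd_iff algebra_simps)
    finally have kd: "k_diagonal e k i y \<longleftrightarrow> e dvd (y + i - k - 1) + 1" .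
    have "(y + 1 + i - k - 1) div e = ((y + i - k - 1) + 1) div e" by (simp add: algebra_simps)
    also have "\<dots> = (y + i - k - 1) div e + of_bool (k_diagonal e k i y)"
      unfolding kd by (rule div_succ_int) (use assms in simp)
    finally show ?thesis using new_content_step[of e k i y] by simp
  qed
  show ?thesis
  proof (induction x rule: int_induct[where k = 0])
    case base
    show ?case by (simp add: new_content_0)
  next
    case (step1 y)
    then show ?case using step[of y] by simp
  next
    case (step2 y)
    then show ?case using step[of "y - 1"] by simp
  qed
qed

lemma new_content_ge:
  assumes "0 \<le> x"
  shows "x \<le> new_content e k i x"
proof -
  have "{b. b < 0 \<and> x \<le> b \<and> k_diagonal e k i b} = {}" using assms by auto
  then show ?thesis unfolding new_content_def by (metis card.empty diff_zero le_add_same_cancel1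
        of_nat_0 of_nat_0_le_iff)
qed

lemma new_content_less_0_iff: "new_content e k i x < 0 \<longleftrightarrow> x < 0"
proof
  assume "new_content e k i x < 0"
  then show "x < 0" using new_content_ge[of x e k i] by linarith
next
  assume "x < 0"
  then have "new_content e k i (x + 1) \<le> new_content e k i 0" by (intro new_content_mono) simp
  then show "new_content e k i x < 0"
    using new_content_step[of e k i x] new_content_0[of e k i] by (simp split: if_splits)
qed

section \<open>The effect of the new runner on positions\<close>

text \<open>Division by \<open>e + 1\<close> recovers row and runner from a position;
  \<open>of_bool (k < b)\<close> undoes the relabelling of the runners to the right of the new
  one.\<close>

lemma bead_positions_insert_runner:
  assumes "0 \<le> k" "k < e" "0 \<le> b" "b \<le> e"
  shows "q * (e + 1) + b \<in> bead_positions (e + 1) (insert_runner k c (abacus e la a)) \<longleftrightarrow>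
    0 \<le> q \<and> (if b = k then q < c else q * e + b - of_bool (k < b) \<in> beta_set la a)"
    (is "_ \<in> bead_positions _ ?X \<longleftrightarrow> _")
proof -
  have rng: "0 \<le> b' \<and> b' < e + 1" if "(q', b') \<in> ?X" for q' b'
    using that assms by (auto simp: insert_runner_def abacus_def)
  have "q * (e + 1) + b \<in> bead_positions (e + 1) ?X \<longleftrightarrow> (q, b) \<in> ?X"
  proof
    assume "q * (e + 1) + b \<in> bead_positions (e + 1) ?X"
    then obtain q' b' where qb: "q * (e + 1) + b = q' * (e + 1) + b'" "(q', b') \<in> ?X"
      unfolding bead_positions_def by blast
    have "(q, b) = (q', b')"
      by (rule inj_onD[OF position_inj[of "e + 1"]]) (use qb rng[OF qb(2)] assms in auto)
    then show "(q, b) \<in> ?X" using qb by simp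
  qed (auto simp: bead_positions_def)
  also have "\<dots> \<longleftrightarrow> 0 \<le> q \<and> (if b = k then q < c else q * e + b - of_bool (k < b) \<in> beta_set la a)"
  proof -
    have "(q, b) \<in> ?X \<longleftrightarrow> (q, b) \<in> abacus e la a \<and> b < k \<or> b = k \<and> 0 \<le> q \<and> q < c \<or>
        (q, b - 1) \<in> abacus e la a \<and> k \<le> b - 1"
      unfolding insert_runner_def by force
    then show ?thesis using assms by (auto simp: abacus_def algebra_simps)
  qed
  finally show ?thesis .
qed

lemma beta_set_nonneg: "z \<in> beta_set la a \<Longrightarrow> 0 \<le> z"
  by (auto simp: beta_set_def)

context
  fixes e k i :: int and la mu :: "nat list" and a c d a' :: int
  assumes k: "0 \<le> k" "k < e"
    and datum: "abacus_datum e k i la (a, c, d, a')"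
    and mu: "int (length mu) \<le> a'"
      "beta_set mu a' = bead_positions (e + 1) (insert_runner k c (abacus e la a))"
begin

text \<open>Since \<open>a\<close> is congruent to \<open>i\<close>, the \<open>k\<close>-diagonals
  are the positions on the old runner \<open>k\<close>.\<close>

lemma k_diagonal_datum: "k_diagonal e k i x \<longleftrightarrow> (x + a) mod e = k"
proof -
  have "(i + x) mod e = (a + x) mod e"
    using datum by (intro mod_add_cong) (auto simp: abacus_datum_def)
  then show ?thesis by (simp add: k_diagonal_def add.commute)
qed

text \<open>The position keeps its row, and its runner is relabelled. The strict \<open><\<close>
  sends the old runner \<open>k\<close> to the new runner, just left of its own new place.\<close>

lemma new_content_datum:
  "new_content e k i x + a' =
    (x + a) div e * (e + 1) + (x + a) mod e + of_bool (k < (x + a) mod e)"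
proof -
  have D: "a + d = c * e + k" "a' = a + c" "0 \<le> d" "d < e"
    using datum by (auto simp: abacus_datum_def)
  have "k_diagonal e k i = k_diagonal e k a"
    by (intro ext) (simp add: k_diagonal_datum, simp add: k_diagonal_def add.commute)
  then have "new_content e k i x = new_content e k a x" by (simp add: new_content_def)
  also have "\<dots> = x + (x + a - k - 1) div e - (a - k - 1) div e" by (rule new_content_eq[OF k])
  \<comment> \<open>The datum gives \<open>a - k - 1 = (c - 1) * e + (e - 1 - d)\<close>, and the
    bounds on \<open>d\<close> make the last term a remainder.\<close>
  also have "(a - k - 1) div e = c - 1"
    by (rule int_div_pos_eq[of _ _ _ "e - 1 - d"]) (use D in \<open>auto simp: algebra_simps\<close>)
  also have "(x + a - k - 1) div e = (x + a) div e - 1 + of_bool (k < (x + a) mod e)"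
  proof -
    define q r where "q = (x + a) div e" and "r = (x + a) mod e"
    have r: "0 \<le> r" "r < e" and z: "x + a = e * q + r" using k by (simp_all add: q_def r_def)
    show ?thesis
      unfolding q_def[symmetric] r_def[symmetric]
      by (rule int_div_pos_eq[of _ _ _ "r - k - 1 + (if k < r then 0 else e)"])
        (use r z k in \<open>auto simp: algebra_simps\<close>)
  qed
  finally show ?thesis using D(2) div_mult_mod_eq[of "x + a" e] by (simp add: algebra_simps)
qed

text \<open>The summand \<open>of_bool\<close> steps over the new runner. In rows
  \<open>q \<ge> 0\<close> the beads correspond; negative rows are full in both Maya
  diagrams.\<close>

lemma maya_old_position:
  "new_content e k i x + of_bool (k_diagonal e k i x) \<in> maya mu \<longleftrightarrow> x \<in> maya la"
proof -
  define q r where "q = (x + a) div e" and "r = (x + a) mod e"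
  have z: "x + a = q * e + r" and r: "0 \<le> r" "r < e" using k by (simp_all add: q_def r_def)
  \<comment> \<open>The label of the old runner \<open>r\<close> after the insertion.\<close>
  define b where "b = r + of_bool (k \<le> r)"
  have b: "0 \<le> b" "b \<le> e" "b \<noteq> k" "b - of_bool (k < b) = r" using r by (auto simp: b_def)
  have pos: "new_content e k i x + of_bool (k_diagonal e k i x) + a' = q * (e + 1) + b"
    using new_content_datum[of x] k_diagonal_datum[of x]
    unfolding q_def[symmetric] r_def[symmetric] b_def by auto
  have "q * (e + 1) + b \<in> beta_set mu a' \<longleftrightarrow> 0 \<le> q \<and> x + a \<in> beta_set la a"
    unfolding mu(2) bead_positions_insert_runner[OF k b(1,2)] z using b(3,4)
    by (simp add: add_diff_eq[symmetric])
  moreover have "0 \<le> q" if "x + a \<in> beta_set la a"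
    using beta_set_nonneg[OF that] k by (simp add: q_def pos_imp_zdiv_nonneg_iff)
  moreover have "q * (e + 1) + b < 0 \<longleftrightarrow> q < 0"
  proof
    assume "q < 0"
    then have "q * (e + 1) \<le> (- 1) * (e + 1)" using k by (intro mult_right_mono) auto
    then show "q * (e + 1) + b < 0" using b by simp
  next
    assume "q * (e + 1) + b < 0"
    then have "q * (e + 1) < 0" using b(1) by linarith
    then show "q < 0" using k by (simp add: mult_less_0_iff)
  qed
  moreover have "x + a < 0 \<longleftrightarrow> q < 0"
    using k pos_imp_zdiv_nonneg_iff[of e "x + a"] by (auto simp: q_def not_le[symmetric])
  moreover have "int (length la) \<le> a" using datum by (simp add: abacus_datum_def)
  ultimately show ?thesis
    using maya_iff_beta_set[of la a x] maya_iff_beta_set[OF mu(1)] pos by auto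
qed

lemma maya_new_position:
  assumes "k_diagonal e k i x"
  shows "new_content e k i x \<in> maya mu \<longleftrightarrow> x < 0"
proof -
  have D: "a + d = c * e + k" "0 \<le> d" "d < e" "0 \<le> a'" "a \<ge> k" "a' = a + c"
    using datum mu(1) by (auto simp: abacus_datum_def)
  define q where "q = (x + a) div e"
  have r: "(x + a) mod e = k" using assms by (simp add: k_diagonal_datum)
  have z: "x + a = q * e + k" unfolding q_def r[symmetric] by simp
  have pos: "new_content e k i x + a' = q * (e + 1) + k"
    using new_content_datum[of x] unfolding q_def[symmetric] r by simp
  have "q * (e + 1) + k \<in> beta_set mu a' \<longleftrightarrow> 0 \<le> q \<and> q < c"
    unfolding mu(2) using bead_positions_insert_runner[OF k, of k] k by simp
  moreover have "q * (e + 1) + k < 0 \<longleftrightarrow> q < 0"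
  proof
    assume "q < 0"
    then have "q * (e + 1) \<le> (- 1) * (e + 1)" using k by (intro mult_right_mono) auto
    then show "q * (e + 1) + k < 0" using k by simp
  next
    assume "q * (e + 1) + k < 0"
    then have "q * (e + 1) < 0" using k by linarith
    then show "q < 0" using k by (simp add: mult_less_0_iff)
  qed
  \<comment> \<open>With \<open>0 \<le> c\<close>, the full negative rows and the \<open>c\<close>
    beads together occupy exactly the rows \<open>q < c\<close> of the new runner.\<close>
  moreover have "0 \<le> c * e" using D by linarith
  then have "0 \<le> c" using k by (simp add: zero_le_mult_iff)
  \<comment> \<open>The datum gives \<open>x = (q - c) * e + d\<close> with
    \<open>0 \<le> d < e\<close>.\<close>
  moreover have "x < 0 \<longleftrightarrow> q < c"
  proof
    assume "x < 0"
    then have "q * e < c * e" using z D by linarith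
    then show "q < c" using k by simp
  next
    assume "q < c"
    then have "q * e \<le> (c - 1) * e" using k by (intro mult_right_mono) auto
    then show "x < 0" using z D by (simp add: algebra_simps)
  qed
  ultimately show ?thesis using maya_iff_beta_set[OF mu(1), of "new_content e k i x"] pos by auto
qed

text \<open>On the new runner the two correction terms of \<open>diag_maya_step\<close>
  cancel.\<close>

lemma diag_new_content_insert:
  assumes "is_partition mu" "k_diagonal e k i x"
  shows "diag mu (new_content e k i x + 1) = diag mu (new_content e k i x)"
  using diag_maya_step[OF assms(1), of "new_content e k i x"]
    maya_new_position[OF assms(2)] new_content_less_0_iff[of e k i x] by simp

lemma diag_new_content:
  assumes "is_partition la" "is_partition mu"
  shows "diag mu (new_content e k i x) = diag la x"
proof -
  let ?n = "new_content e k i"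
  define D where "D x = int (diag mu (?n x)) - int (diag la x)" for x
  have step: "D (x + 1) = D x" for x
  proof -
    \<comment> \<open>The last content stemming from \<open>x\<close>: the step from
      \<open>m\<close> to \<open>m + 1\<close> in \<open>mu\<close> mirrors the step from
      \<open>x\<close> to \<open>x + 1\<close> in \<open>la\<close>.\<close>
    define m where "m = ?n x + of_bool (k_diagonal e k i x)"
    have "diag mu m = diag mu (?n x)"
      using diag_new_content_insert[OF assms(2), of x] by (simp add: m_def)
    moreover have "?n (x + 1) = m + 1" by (simp add: m_def new_content_step)
    moreover have "m < 0 \<longleftrightarrow> x < 0"
      using new_content_less_0_iff[of e k i x] new_content_less_0_iff[of e k i "x + 1"]
        new_content_0[of e k i] \<open>?n (x + 1) = m + 1\<close>
      by (cases "x = - 1") (auto simp: m_def)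
    moreover have "m \<in> maya mu \<longleftrightarrow> x \<in> maya la" unfolding m_def by (rule maya_old_position)
    ultimately show ?thesis
      using diag_maya_step[OF assms(1), of x] diag_maya_step[OF assms(2), of m]
      by (simp add: D_def)
  qed
  \<comment> \<open>Far enough right for both diagonals to be empty, since
    \<open>N \<le> ?n N\<close>.\<close>
  define N where "N = int (length la + part la 1 + length mu + part mu 1)"
  have "D x = 0"
  proof (induction x rule: int_induct[where k = N])
    case base
    have "diag mu (?n N) = 0"
      using new_content_ge[of N e k i] by (intro diag_eq_0[OF assms(2)]) (simp add: N_def)
    moreover have "diag la N = 0" by (intro diag_eq_0[OF assms(1)]) (simp add: N_def)
    ultimately show ?case by (simp add: D_def)
  next
    case (step1 y)
    then show ?case using step[of y] by simp
  next
    case (step2 y)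
    then show ?case using step[of "y - 1"] by simp
  qed
  then show ?thesis by (simp add: D_def)
qed

end

theorem theorem5p44:
  fixes e k i :: int and la :: "nat list" and a c d a' :: int
  assumes "e \<ge> 3" and "k \<in> {0..e - 1}" and "i \<in> {0..e - 1}"
    and "is_partition la"
    and "abacus_datum e k i la (a, c, d, a')"
  shows "Phi_Y e k i la = Phi_A e k (a, c, d, a') la"
proof -
  have k: "0 \<le> k" "k < e" "0 < e" using assms by auto
  define mu where "mu = Phi_A e k (a, c, d, a') la"
  have mu: "is_partition mu \<and> int (length mu) \<le> a' \<and>
      beta_set mu a' = bead_positions (e + 1) (insert_runner k c (abacus e la a))"
    unfolding mu_def Phi_A_def prod.case
    by (rule theI'[OF Phi_A_well_defined]) (use assms k in auto)
  have old: "diag mu (new_content e k i x) = diag la x" for x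
    using diag_new_content[OF k(1,2) assms(5)] mu assms(4) by blast
  moreover have "diag mu (new_content e k i b + 1) = diag la b" if "k_diagonal e k i b" for b
    using diag_new_content_insert[OF k(1,2) assms(5)] mu that old by metis
  \<comment> \<open>\<open>mu\<close> has the property that characterises \<open>Phi_Y\<close>
    uniquely.\<close>
  ultimately have "Phi_Y e k i la = mu"
    unfolding Phi_Y_def using mu by (intro the1_equality[OF Phi_Y_well_defined[OF assms(4)]]) auto
  then show ?thesis by (simp add: mu_def)
qed

end
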